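(* Let $m\in\mathbb{N}$ and let $x_1,\dots,x_m\in\mathbb{R}$ with $x_1+\cdots+x_m=x$. Then, for every $n\in\mathbb{N}_0$, $$\sum_{j_1+\cdots+j_m=n}\binom{n}{j_1,\dots,j_m}B_{j_1}(x_1)\cdots B_{j_m}(x_m)=B_n(m;x)=\sum_{k=0}^n\frac{s(m+k,m)}{k!\binom{m+k}{m}}\Delta^kI_n(x).$$ In addition, for $m=2$ (so $x=x_1+x_2$), $$\sum_{k=0}^n\binom{n}{k}B_k(x_1)B_{n-k}(x_2)=B_n(2;x)=2\sum_{k=0}^n\frac{(-1)^kH_{k+1}}{k+2}\Delta^kI_n(x).$$
   Context: $\mathbb{N}=\{1,2,\dots\}$, $\mathbb{N}_0=\mathbb{N}\cup\{0\}$. The first sum is over $j_1,\dots,j_m\in\mathbb{N}_0$, and $\binom{n}{j_1,\dots,j_m}=\frac{n!}{j_1!\cdots j_m!}$. The generalized Bernoulli polynomials $B_n(t;x)$ of order $t\in\mathbb{R}$ are defined by $\sum_{n\ge0}B_n(t;x)\frac{z^n}{n!}=\left(\frac{z}{e^z-1}\right)^te^{xz}$ for complex $z$ near $0$ (with the branch equal to $1$ at $z=0$); $B_n(x)=B_n(1;x)$ are the classical Bernoulli polynomials. $\Delta^kf(x)=\sum_{j=0}^k\binom{k}{j}(-1)^{k-j}f(x+j)$ and $I_n(x)=x^n$. $s(n,k)$ are the (signed) Stirling numbers of the first kind, $x(x-1)\cdots(x-n+1)=\sum_{k=0}^ns(n,k)x^k$. $H_k=\sum_{j=1}^k\frac1j$,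 $k\in\mathbb{N}$. *)

theory Defs
  imports
    "HOL-Complex_Analysis.Complex_Analysis"
    "HOL-Computational_Algebra.Polynomial"
begin

text \<open>
  The quotient \<open>z / (e^z - 1)\<close> is completed by its limit 1 at 0. As it is close to 1 for
  small \<open>z\<close>, the principal power \<open>powr\<close> is there the analytic branch with value 1 at 0.
\<close>
definition gen_bernoulli_gf :: "real \<Rightarrow> real \<Rightarrow> complex \<Rightarrow> complex" where
  "gen_bernoulli_gf t x z =
     (if z = 0 then 1 else z / (exp z - 1)) powr of_real t * exp (of_real x * z)"

text \<open>
  \<open>gen_bernoulli n t x\<close> is $B_n(t;x)$. That the defining sequence exists and is unique is
  shown in \<open>gen_bernoulli_has_fps_expansion\<close> and \<open>gen_bernoulli_unique\<close> below.
\<close>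
definition gen_bernoulli :: "nat \<Rightarrow> real \<Rightarrow> real \<Rightarrow> real" where
  "gen_bernoulli n t x =
     (THE b :: nat \<Rightarrow> real.
        gen_bernoulli_gf t x has_fps_expansion
          Abs_fps (\<lambda>k. complex_of_real (b k) / fact k)) n"

definition bernoulli_poly :: "nat \<Rightarrow> real \<Rightarrow> real" where
  "bernoulli_poly n x = gen_bernoulli n 1 x"

definition fwd_diff :: "nat \<Rightarrow> (real \<Rightarrow> real) \<Rightarrow> real \<Rightarrow> real" where
  "fwd_diff k f x = (\<Sum>j=0..k. real (k choose j) * (-1) ^ (k - j) * f (x + real j))"

text \<open>
  Signed Stirling numbers of the first kind (\<open>stirling\<close> in
  \<open>HOL-Combinatorics.Stirling\<close> is the unsigned version).
\<close>
definition signed_stirling1 :: "nat \<Rightarrow> nat \<Rightarrow> int" where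
  "signed_stirling1 n k = coeff (\<Prod>i<n. [:- int i, 1:]) k"

definition weak_compositions :: "nat \<Rightarrow> nat \<Rightarrow> (nat \<Rightarrow> nat) set" where
  "weak_compositions m n = {j \<in> {1..m} \<rightarrow>\<^sub>E UNIV. (\<Sum>i=1..m. j i) = n}"

definition multinomial :: "nat \<Rightarrow> nat \<Rightarrow> (nat \<Rightarrow> nat) \<Rightarrow> real" where
  "multinomial n m j = fact n / (\<Prod>i=1..m. fact (j i))"

lemma finite_weak_compositions: "finite (weak_compositions m n)"
proof (rule finite_subset)
  show "weak_compositions m n \<subseteq> {1..m} \<rightarrow>\<^sub>E {..n}"
  proof
    fix j assume "j \<in> weak_compositions m n"
    hence j: "j \<in> {1..m} \<rightarrow>\<^sub>E UNIV" "(\<Sum>i=1..m. j i) = n"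
      by (auto simp: weak_compositions_def)
    have "j i \<le> n" if "i \<in> {1..m}" for i
      using member_le_sum[of i "{1..m}" j] that j(2) by simp
    thus "j \<in> {1..m} \<rightarrow>\<^sub>E {..n}"
      using j(1) by (auto simp: PiE_iff)
  qed
  show "finite ({1..m} \<rightarrow>\<^sub>E {..n})"
    by (intro finite_PiE) auto
qed

lemma signed_stirling1_falling_factorial:
  fixes x :: real
  shows "(\<Prod>i<n. x - real i) = (\<Sum>k=0..n. of_int (signed_stirling1 n k) * x ^ k)"
proof -
  define p where "p = (\<lambda>n. \<Prod>i<n. [:- int i, 1:])"
  have p_Suc: "p (Suc n) = smult (- int n) (p n) + pCons 0 (p n)" for n
    by (simp add: p_def)
  have step: "map_poly real_of_int (p (Suc n)) = map_poly real_of_int (p n) * [:- real n, 1:]" for n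
    unfolding p_Suc
    by (rule poly_eqI) (auto simp: coeff_map_poly coeff_pCons split: nat.splits)
  have "map_poly real_of_int (p n) = (\<Prod>i<n. [:- real i, 1:])"
  proof (induction n)
    case 0
    show ?case by (simp add: p_def map_poly_pCons one_pCons)
  next
    case (Suc n)
    thus ?case by (simp only: step prod.lessThan_Suc)
  qed
  hence "(\<Prod>i<n. x - real i) = poly (map_poly real_of_int (p n)) x"
    by (simp add: poly_prod)
  moreover have "degree (map_poly real_of_int (p n)) = n"
    by (subst degree_map_poly) (auto simp: p_def degree_prod_eq_sum_degree)
  ultimately show ?thesis
    by (simp add: poly_altdef coeff_map_poly signed_stirling1_def p_def atMost_atLeast0)
qed

lemma gen_bernoulli_unique:
  assumes "f has_fps_expansion Abs_fps (\<lambda>k. complex_of_real (b k) / fact k)"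
  assumes "f has_fps_expansion Abs_fps (\<lambda>k. complex_of_real (c k) / fact k)"
  shows   "b = c"
proof
  fix k
  have "complex_of_real (b k) = complex_of_real (c k)"
    using fps_nth_fps_expansion[OF assms(1), of k] fps_nth_fps_expansion[OF assms(2), of k]
    by simp
  thus "b k = c k"
    by (simp only: of_real_eq_iff)
qed

lemma gen_bernoulli_quotient_analytic:
  "(\<lambda>z :: complex. if z = 0 then 1 else z / (exp z - 1)) analytic_on {0}"
proof -
  have "subdegree (fps_exp 1 - 1 :: complex fps) = 1"
    by (rule subdegreeI) auto
  hence "(\<lambda>z :: complex. if z = 0 then 1 else z / (exp z - 1))
           has_fps_expansion fps_X / (fps_exp 1 - 1)"
    by (intro has_fps_expansion_divide has_fps_expansion_diff has_fps_expansion_exp1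
          has_fps_expansion_1 has_fps_expansion_fps_X) auto
  thus ?thesis
    by (rule has_fps_expansion_imp_analytic_0)
qed

lemma gen_bernoulli_gf_analytic: "gen_bernoulli_gf t x analytic_on {0}"
  unfolding gen_bernoulli_gf_def[abs_def]
  by (intro analytic_intros gen_bernoulli_quotient_analytic) auto

lemma gen_bernoulli_gf_cnj:
  "eventually (\<lambda>z. gen_bernoulli_gf t x (cnj z) = cnj (gen_bernoulli_gf t x z)) (nhds 0)"
proof -
  define g :: "complex \<Rightarrow> complex" where "g = (\<lambda>z. if z = 0 then 1 else z / (exp z - 1))"
  have "isCont g 0"
    using gen_bernoulli_quotient_analytic
    unfolding g_def by (simp add: analytic_at_imp_isCont)
  moreover have "open (- \<real>\<^sub>\<le>\<^sub>0 :: complex set)" "g 0 \<in> - \<real>\<^sub>\<le>\<^sub>0"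
    by (auto simp: g_def)
  ultimately have "eventually (\<lambda>z. g z \<in> - \<real>\<^sub>\<le>\<^sub>0) (nhds 0)"
    by (metis isCont_def tendsto_at_iff_tendsto_nhds topological_tendstoD)
  thus ?thesis
  proof eventually_elim
    case (elim z)
    have "Im (g z) = 0 \<Longrightarrow> 0 \<le> Re (g z)"
      using elim by (auto simp: complex_nonpos_Reals_iff)
    hence "cnj (g z powr of_real t) = cnj (g z) powr of_real t"
      by (simp add: cnj_powr)
    moreover have "cnj (g z) = g (cnj z)"
      by (simp add: g_def exp_cnj)
    moreover have "gen_bernoulli_gf t x w = g w powr of_real t * exp (of_real x * w)" for w
      by (simp add: gen_bernoulli_gf_def g_def)
    ultimately show ?case
      by (simp add: exp_cnj)
  qed
qed

lemma gen_bernoulli_has_fps_expansion: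
  "gen_bernoulli_gf t x has_fps_expansion
     Abs_fps (\<lambda>n. complex_of_real (gen_bernoulli n t x) / fact n)"
proof -
  let ?f = "gen_bernoulli_gf t x"
  obtain F where F: "?f has_fps_expansion F"
    using analytic_at_imp_has_fps_expansion_0[OF gen_bernoulli_gf_analytic] by blast
  define G where "G = Abs_fps (\<lambda>n. cnj (fps_nth F n))"
  have rad: "fps_conv_radius G = fps_conv_radius F"
  proof -
    have "conv_radius (fps_nth G) = conv_radius (\<lambda>n. norm (fps_nth G n))"
      by simp
    also have "(\<lambda>n. norm (fps_nth G n)) = (\<lambda>n. norm (fps_nth F n))"
      by (simp add: G_def)
    also have "conv_radius \<dots> = conv_radius (fps_nth F)"
      by simp
    finally show ?thesis by (simp add: fps_conv_radius_def)
  qed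
  have pos: "fps_conv_radius F > 0" and ev: "eventually (\<lambda>z. eval_fps F z = ?f z) (nhds 0)"
    using F by (auto simp: has_fps_expansion_def)
  have "filterlim cnj (nhds 0) (nhds 0)"
    using tendsto_cnj[OF filterlim_ident, of "0 :: complex"] by simp
  hence ev': "eventually (\<lambda>z. eval_fps F (cnj z) = ?f (cnj z)) (nhds 0)"
    using ev by (rule eventually_compose_filterlim[rotated])
  have "eventually (\<lambda>z. z \<in> eball 0 (fps_conv_radius F)) (nhds (0 :: complex))"
    using pos by (intro eventually_nhds_in_open) (auto simp: zero_ereal_def)
  hence "eventually (\<lambda>z. eval_fps G z = ?f z) (nhds 0)"
    using ev' gen_bernoulli_gf_cnj[of t x]
  proof eventually_elim
    case (elim z)
    have "(\<lambda>n. fps_nth F n * cnj z ^ n) sums eval_fps F (cnj z)"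
      using elim(1) by (intro sums_eval_fps) (auto simp: in_eball_iff)
    hence "(\<lambda>n. cnj (fps_nth F n * cnj z ^ n)) sums cnj (eval_fps F (cnj z))"
      by (simp only: sums_cnj)
    hence "eval_fps G z = cnj (eval_fps F (cnj z))"
      by (simp add: eval_fps_def G_def sums_iff)
    thus ?case
      using elim by simp
  qed
  hence G: "?f has_fps_expansion G"
    using pos rad by (simp add: has_fps_expansion_def)
  define b where "b = (\<lambda>n. Re (fps_nth F n) * fact n)"
  have "cnj (fps_nth F n) = fps_nth F n" for n
    using fps_nth_fps_expansion[OF F, of n] fps_nth_fps_expansion[OF G, of n]
    by (simp add: G_def)
  hence "fps_nth F n = of_real (Re (fps_nth F n))" for n
    by (metis Reals_cnj_iff of_real_Re)
  hence "F = Abs_fps (\<lambda>n. complex_of_real (b n) / fact n)"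
    by (auto simp: fps_eq_iff b_def)
  with F have b: "?f has_fps_expansion Abs_fps (\<lambda>n. complex_of_real (b n) / fact n)"
    by simp
  have "(THE b. ?f has_fps_expansion Abs_fps (\<lambda>n. complex_of_real (b n) / fact n)) = b"
    by (rule the_equality, rule b, erule gen_bernoulli_unique[OF _ b])
  with b show ?thesis
    by (simp add: gen_bernoulli_def)
qed

end

theory Submission
  imports Defs
begin

text \<open>
  Both identities come from the exponential generating function
  \<open>(z / (e\<^sup>z - 1))\<^sup>t e\<^bsup>xz\<^esup>\<close> of \<open>B\<^sub>n(t;x)\<close>, regarded as a formal power series in \<open>z\<close>.

  The series is multiplicative in the pair \<open>(t, x)\<close>: adding orders and adding arguments
  multiplies the series (\<open>gen_bernoulli_fps_add\<close>). Comparing coefficients in an \<open>m\<close>-fold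
  product gives the multinomial convolution formula, for arbitrary real orders
  (\<open>gen_bernoulli_convolution\<close>); the classical polynomials are the case where every order is 1.

  For the difference formula, put \<open>u = e\<^sup>z - 1\<close>, so that \<open>z = ln (1 + u)\<close> and
  \<open>(z / (e\<^sup>z - 1))\<^sup>m = (ln (1 + u) / u)\<^sup>m\<close> becomes a power series in \<open>u\<close>. Since
  \<open>ln (1 + u)\<^sup>m / m!\<close> is the exponential generating function of \<open>s(n, m)\<close>
  (\<open>signed_stirling1_egf\<close>), its coefficients are
  \<open>m! s(m + k, m) / (m + k)! = s(m + k, m) / (k! binom(m + k, m))\<close>. On the other hand,
  \<open>u\<^sup>k e\<^bsup>xz\<^esup> = (e\<^sup>z - 1)\<^sup>k e\<^bsup>xz\<^esup>\<close> is the exponential generating function, in \<open>n\<close>, of the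
  differences \<open>\<Delta>\<^sup>k I\<^sub>n(x)\<close> (\<open>fwd_diff_power_egf\<close>). As \<open>u\<^sup>k\<close> has no terms below \<open>z\<^sup>k\<close>, only
  the indices \<open>k \<le> n\<close> contribute to the \<open>n\<close>-th coefficient. For \<open>m = 2\<close> the Stirling
  numbers are evaluated through harmonic numbers, by \<open>s(k + 2, 2) = (-1)\<^sup>k (k + 1)! H\<^bsub>k+1\<^esub>\<close>.
\<close>

section \<open>Convolution of generalized Bernoulli polynomials\<close>

definition gen_bernoulli_fps :: "real \<Rightarrow> real \<Rightarrow> complex fps" where
  "gen_bernoulli_fps t x = Abs_fps (\<lambda>n. complex_of_real (gen_bernoulli n t x) / fact n)"

text \<open>
  The expansion of a function at 0 is unique, so a closed form of the series can be read off
  from any expansion of the generating function.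
\<close>
lemma gen_bernoulli_fps_eqI:
  "gen_bernoulli_gf t x has_fps_expansion F \<Longrightarrow> gen_bernoulli_fps t x = F"
  unfolding gen_bernoulli_fps_def
  by (rule fps_expansion_unique_complex[OF gen_bernoulli_has_fps_expansion])

text \<open>
  Holds for all real orders: both factors use the same branch of the logarithm of
  \<open>z / (e\<^sup>z - 1)\<close>, and for a fixed branch exponents add.
\<close>
lemma gen_bernoulli_fps_add:
  "gen_bernoulli_fps (s + t) (x + y) = gen_bernoulli_fps s x * gen_bernoulli_fps t y"
proof (rule gen_bernoulli_fps_eqI)
  have "gen_bernoulli_gf (s + t) (x + y) = (\<lambda>z. gen_bernoulli_gf s x z * gen_bernoulli_gf t y z)"
    by (auto simp: gen_bernoulli_gf_def fun_eq_iff powr_add exp_add ring_distribs)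
  moreover have "\<dots> has_fps_expansion gen_bernoulli_fps s x * gen_bernoulli_fps t y"
    unfolding gen_bernoulli_fps_def
    by (intro has_fps_expansion_mult gen_bernoulli_has_fps_expansion)
  ultimately show "gen_bernoulli_gf (s + t) (x + y) has_fps_expansion
                     gen_bernoulli_fps s x * gen_bernoulli_fps t y"
    by simp
qed

lemma gen_bernoulli_fps_sum:
  assumes "finite A" "A \<noteq> {}"
  shows "gen_bernoulli_fps (\<Sum>i\<in>A. t i) (\<Sum>i\<in>A. x i) = (\<Prod>i\<in>A. gen_bernoulli_fps (t i) (x i))"
  using assms by (induction rule: finite_ne_induct) (simp_all add: gen_bernoulli_fps_add)

text \<open>
  A composition \<open>j\<close> of \<open>n\<close> is the same as a multiset of size \<open>n\<close> over \<open>{1..m}\<close> in which \<open>i\<close>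
  occurs \<open>j i\<close> times. This bijection turns the expansion of a finite product over multisets
  into one over compositions.
\<close>
lemma fps_nth_prod_weak_compositions:
  fixes F :: "nat \<Rightarrow> 'a :: comm_ring_1 fps"
  shows "fps_nth (\<Prod>i=1..m. F i) n = (\<Sum>j\<in>weak_compositions m n. \<Prod>i=1..m. fps_nth (F i) (j i))"
proof -
  let ?f = "\<lambda>X :: nat multiset. restrict (count X) {1..m}"
  let ?g = "\<lambda>j :: nat \<Rightarrow> nat. \<Sum>i=1..m. replicate_mset (j i) i"
  have count_g: "count (?g j) k = (if k \<in> {1..m} then j k else 0)" for j k
    by (simp add: count_sum if_distrib cong: if_cong)
  have set_g: "set_mset (?g j) \<subseteq> {1..m}" for j
    by (auto simp: set_mset_sum split: if_splits)
  have "(\<Sum>X\<in>multisets_of_size {1..m} n. \<Prod>i=1..m. fps_nth (F i) (count X i)) =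
        (\<Sum>j\<in>weak_compositions m n. \<Prod>i=1..m. fps_nth (F i) (j i))"
  proof (rule sum.reindex_bij_witness[of _ ?g ?f])
    fix X assume X: "X \<in> multisets_of_size {1..m} n"
    hence sub: "set_mset X \<subseteq> {1..m}" and sz: "size X = n"
      by (auto simp: multisets_of_size_def)
    show "?g (?f X) = X"
    proof (rule multiset_eqI)
      fix k
      have "count (?g (?f X)) k = (if k \<in> {1..m} then ?f X k else 0)"
        by (rule count_g)
      also have "\<dots> = count X k"
        using sub by (auto simp flip: not_in_iff)
      finally show "count (?g (?f X)) k = count X k" .
    qed
    have "(\<Sum>i=1..m. count X i) = size X"
      unfolding size_multiset_overloaded_eq
      by (rule sum.mono_neutral_right) (use sub in \<open>auto simp: count_eq_zero_iff\<close>)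
    thus "?f X \<in> weak_compositions m n"
      using sz by (auto simp: weak_compositions_def)
  next
    fix j assume j: "j \<in> weak_compositions m n"
    hence ext: "j \<in> {1..m} \<rightarrow>\<^sub>E UNIV" and sm: "(\<Sum>i=1..m. j i) = n"
      by (auto simp: weak_compositions_def)
    have "?f (?g j) = restrict j {1..m}"
      by (rule restrict_ext) (simp only: count_g if_True)
    thus "?f (?g j) = j"
      using ext by (simp only: PiE_restrict)
    have "size (?g j) = n"
      using sm by simp
    thus "?g j \<in> multisets_of_size {1..m} n"
      using set_g by (simp add: multisets_of_size_def)
  qed (auto intro!: prod.cong)
  thus ?thesis
    by (simp add: fps_prod_nth')
qed

lemma gen_bernoulli_convolution:
  assumes "m \<ge> 1"
  shows "(\<Sum>j\<in>weak_compositions m n. multinomial n m j * (\<Prod>i=1..m. gen_bernoulli (j i) (t i) (x i)))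
         = gen_bernoulli n (\<Sum>i=1..m. t i) (\<Sum>i=1..m. x i)"
proof -
  have "complex_of_real (gen_bernoulli n (\<Sum>i=1..m. t i) (\<Sum>i=1..m. x i))
          = fact n * fps_nth (\<Prod>i=1..m. gen_bernoulli_fps (t i) (x i)) n"
    using assms by (simp flip: gen_bernoulli_fps_sum) (simp add: gen_bernoulli_fps_def)
  also have "\<dots> = of_real (\<Sum>j\<in>weak_compositions m n.
                      multinomial n m j * (\<Prod>i=1..m. gen_bernoulli (j i) (t i) (x i)))"
    unfolding fps_nth_prod_weak_compositions
    by (simp add: gen_bernoulli_fps_def multinomial_def sum_distrib_left prod_dividef)
  finally show ?thesis
    by (simp only: of_real_eq_iff)
qed

text \<open>
  Summing over one index instead of over compositions into two parts gives the form in which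
  Euler's identity for Bernoulli polynomials is usually stated.
\<close>
lemma gen_bernoulli_convolution_binomial:
  "(\<Sum>k=0..n. real (n choose k) * gen_bernoulli k s x * gen_bernoulli (n - k) t y)
     = gen_bernoulli n (s + t) (x + y)"
proof -
  have "complex_of_real (gen_bernoulli n (s + t) (x + y))
          = fact n * fps_nth (gen_bernoulli_fps s x * gen_bernoulli_fps t y) n"
    by (simp flip: gen_bernoulli_fps_add) (simp add: gen_bernoulli_fps_def)
  also have "\<dots> = of_real (\<Sum>k=0..n. real (n choose k) * gen_bernoulli k s x * gen_bernoulli (n - k) t y)"
    by (simp add: fps_mult_nth gen_bernoulli_fps_def sum_distrib_left binomial_fact mult.assoc)
  finally show ?thesis
    by (simp only: of_real_eq_iff)
qed

section \<open>Stirling numbers of the first kind and powers of the logarithm\<close>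

lemma signed_stirling1_0 [simp]: "signed_stirling1 0 k = (if k = 0 then 1 else 0)"
  by (simp add: signed_stirling1_def)

lemma signed_stirling1_Suc_Suc:
  "signed_stirling1 (Suc n) (Suc k) = signed_stirling1 n k - int n * signed_stirling1 n (Suc k)"
  by (simp add: signed_stirling1_def)

lemma signed_stirling1_Suc_0 [simp]: "signed_stirling1 (Suc n) 0 = 0"
  by (induction n) (simp_all add: signed_stirling1_def)

text \<open>
  Let \<open>G\<^sub>k\<close> be the series on the left. The triangular recurrence of the Stirling numbers is
  exactly the differential equation \<open>(1 + X) G\<^bsub>k+1\<^esub>' = G\<^sub>k\<close>. As \<open>ln (1 + X)\<close> has derivative
  \<open>1 / (1 + X)\<close>, the series \<open>ln (1 + X)\<^sup>k / k!\<close> satisfy the same equations, and for \<open>k > 0\<close>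
  both sides have constant term 0.
\<close>
lemma signed_stirling1_egf:
  "Abs_fps (\<lambda>n. of_int (signed_stirling1 n k) / fact n :: 'a :: field_char_0)
     = fps_const (1 / fact k) * fps_ln 1 ^ k"
proof (induction k)
  case 0
  have "signed_stirling1 n 0 = (if n = 0 then 1 else 0)" for n
    by (cases n) simp_all
  thus ?case
    by (simp add: fps_eq_iff)
next
  case (Suc k)
  define G where "G = (\<lambda>k. Abs_fps (\<lambda>n. of_int (signed_stirling1 n k) / fact n :: 'a))"
  let ?L = "fps_ln 1 :: 'a fps"
  have ode: "(1 + fps_X) * fps_deriv (G (Suc k)) = G k"
  proof (rule fps_ext)
    fix n
    have "fps_nth (fps_deriv (G (Suc k))) n = of_int (signed_stirling1 (Suc n) (Suc k)) / fact n" for n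
      by (simp add: G_def field_simps del: of_nat_Suc)
    moreover have "fps_nth ((1 + fps_X) * fps_deriv (G (Suc k))) n =
       fps_nth (fps_deriv (G (Suc k))) n + of_nat n * fps_nth (G (Suc k)) n"
      by (cases n) (simp_all add: ring_distribs)
    ultimately show "fps_nth ((1 + fps_X) * fps_deriv (G (Suc k))) n = fps_nth (G k) n"
      by (simp add: G_def signed_stirling1_Suc_Suc field_simps)
  qed
  have inv: "inverse (1 + fps_X) * (1 + fps_X) = (1 :: 'a fps)"
    by (rule inverse_mult_eq_1) simp
  have deriv_pow: "fps_deriv (?L ^ Suc k) = fps_const (of_nat (Suc k)) * inverse (1 + fps_X) * ?L ^ k"
    using fps_deriv_power[of ?L "Suc k"] by (simp add: fps_ln_deriv del: power_Suc of_nat_Suc)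
  have "fps_deriv (G (Suc k)) = inverse (1 + fps_X) * ((1 + fps_X) * fps_deriv (G (Suc k)))"
    using inv by (simp flip: mult.assoc)
  also have "\<dots> = fps_const (1 / fact k) * ?L ^ k * inverse (1 + fps_X)"
    unfolding ode using Suc.IH by (simp add: G_def)
  also have "1 / fact k = (1 / fact (Suc k) * of_nat (Suc k) :: 'a)"
    by (simp add: field_simps del: of_nat_Suc)
  also have "fps_const (1 / fact (Suc k) * of_nat (Suc k)) * ?L ^ k * inverse (1 + fps_X) =
        fps_deriv (fps_const (1 / fact (Suc k)) * ?L ^ Suc k)"
    by (simp add: deriv_pow mult_ac del: of_nat_Suc fact_Suc power_Suc flip: fps_const_mult)
  finally have "G (Suc k) = fps_const (fps_nth (G (Suc k)) 0 -
      fps_nth (fps_const (1 / fact (Suc k)) * ?L ^ Suc k) 0) + fps_const (1 / fact (Suc k)) * ?L ^ Suc k"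
    by (subst (asm) fps_deriv_eq_iff)
  thus ?case
    by (simp add: G_def)
qed

lemma signed_stirling1_Suc_1: "signed_stirling1 (Suc n) 1 = (-1) ^ n * fact n"
  by (induction n) (simp_all add: signed_stirling1_Suc_Suc)

text \<open>
  With signs and factorials divided out, the recurrence for \<open>s(n + 3, 2)\<close> becomes \<open>H\<^bsub>n+2\<^esub> = H\<^bsub>n+1\<^esub> + 1 / (n + 2)\<close>, where
  the added term is the contribution of \<open>s(n + 2, 1)\<close>.
\<close>
lemma signed_stirling1_2:
  "real_of_int (signed_stirling1 (n + 2) 2) = (-1) ^ n * fact (n + 1) * harm (n + 1)"
proof (induction n)
  case 0
  show ?case
    by (simp add: numeral_2_eq_2 signed_stirling1_Suc_Suc harm_def)
next
  case (Suc n)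
  have "signed_stirling1 (Suc n + 2) 2 =
          signed_stirling1 (Suc (n + 1)) 1 - int (n + 2) * signed_stirling1 (n + 2) 2"
    using signed_stirling1_Suc_Suc[of "n + 2" 1] by (simp add: numeral_2_eq_2)
  hence "real_of_int (signed_stirling1 (Suc n + 2) 2) =
          (-1) ^ (n + 1) * fact (n + 1) - real (n + 2) * ((-1) ^ n * fact (n + 1) * harm (n + 1))"
    unfolding signed_stirling1_Suc_1 by (simp only: Suc.IH [symmetric]) simp
  also have "\<dots> = (-1) ^ Suc n * fact (Suc n + 1) * harm (Suc n + 1)"
    by (simp add: harm_Suc[of "Suc n"] field_simps)
  finally show ?case .
qed

section \<open>Expansion in forward differences\<close>

text \<open>
  For a positive integer order the principal power is an ordinary power, and so the series
  is an explicit formal expression.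
\<close>
lemma gen_bernoulli_fps_of_nat:
  assumes "m \<ge> 1"
  shows "gen_bernoulli_fps (real m) x = (fps_X / (fps_exp 1 - 1)) ^ m * fps_exp (of_real x)"
proof (rule gen_bernoulli_fps_eqI)
  have "subdegree (fps_exp 1 - 1 :: complex fps) = 1"
    by (rule subdegreeI) auto
  hence "(\<lambda>z :: complex. if z = 0 then 1 else z / (exp z - 1))
           has_fps_expansion fps_X / (fps_exp 1 - 1)"
    by (intro has_fps_expansion_divide has_fps_expansion_diff has_fps_expansion_exp1
          has_fps_expansion_1 has_fps_expansion_fps_X) auto
  hence "(\<lambda>z :: complex. (if z = 0 then 1 else z / (exp z - 1)) ^ m * exp (of_real x * z))
           has_fps_expansion (fps_X / (fps_exp 1 - 1)) ^ m * fps_exp (of_real x)"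
    by (intro has_fps_expansion_mult has_fps_expansion_power has_fps_expansion_exp)
  thus "gen_bernoulli_gf (real m) x has_fps_expansion
          (fps_X / (fps_exp 1 - 1)) ^ m * fps_exp (of_real x)"
    using assms by (simp add: gen_bernoulli_gf_def[abs_def] powr_nat')
qed

text \<open>
  The substitution \<open>u = e\<^sup>z - 1\<close> takes \<open>ln (1 + u)\<close> to \<open>z\<close>, so the left-hand side is
  \<open>(ln (1 + u) / u)\<^sup>m\<close> composed with \<open>e\<^sup>z - 1\<close>, and dividing by \<open>u\<^sup>m\<close> shifts the coefficients
  given by \<open>signed_stirling1_egf\<close> by \<open>m\<close> places.
\<close>
lemma fps_X_div_exp_minus_1_power:
  "(fps_X / (fps_exp 1 - 1)) ^ m =
     Abs_fps (\<lambda>k. of_int (signed_stirling1 (m + k) m) / (fact k * of_nat ((m + k) choose m)))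
       oo (fps_exp 1 - 1 :: 'a :: field_char_0 fps)"
proof -
  let ?E = "fps_exp 1 - 1 :: 'a fps" and ?L = "fps_ln 1 :: 'a fps"
  have E0: "fps_nth ?E 0 = 0"
    by simp
  have dvd: "fps_X dvd ?L"
    by (rule fps_X_dvd_fps_ln)
  have "?L oo ?E = fps_X"
    by (simp add: fps_ln_fps_exp_inv fps_inv_fps_exp_compose)
  hence "(?L / fps_X) oo ?E = fps_X / ?E"
    by (subst fps_compose_divide_distrib[OF dvd]) simp_all
  hence comp: "(fps_X / ?E) ^ m = (?L / fps_X) ^ m oo ?E"
    by (simp only: fps_compose_power[OF E0, symmetric])
  have "?L / fps_X * fps_X = ?L"
    using dvd by (rule dvd_div_mult_self)
  hence "(?L / fps_X) ^ m * fps_X ^ m = ?L ^ m"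
    by (simp only: flip: power_mult_distrib)
  also have "\<dots> = fps_const (fact m) * (fps_const (1 / fact m) * ?L ^ m)"
    by (simp flip: mult.assoc)
  finally have quot: "(?L / fps_X) ^ m * fps_X ^ m =
        fps_const (fact m) * Abs_fps (\<lambda>n. of_int (signed_stirling1 n m) / fact n)"
    by (simp only: signed_stirling1_egf)
  have coeff: "fps_nth ((?L / fps_X) ^ m) k =
        of_int (signed_stirling1 (m + k) m) / (fact k * of_nat ((m + k) choose m))" for k
  proof -
    have "fps_nth ((?L / fps_X) ^ m) k = fps_nth ((?L / fps_X) ^ m * fps_X ^ m) (m + k)"
      by (simp only: fps_X_power_mult_right_nth) simp
    also have "\<dots> = fact m * of_int (signed_stirling1 (m + k) m) / fact (m + k)"
      unfolding quot by simp
    also have "\<dots> = of_int (signed_stirling1 (m + k) m) / (fact k * of_nat ((m + k) choose m))"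
      by (simp add: binomial_fact)
    finally show ?thesis .
  qed
  have "(?L / fps_X) ^ m =
    Abs_fps (\<lambda>k. of_int (signed_stirling1 (m + k) m) / (fact k * of_nat ((m + k) choose m)))"
    by (rule fps_ext) (simp only: coeff fps_nth_Abs_fps)
  with comp show ?thesis
    by simp
qed

text \<open>
  Multiplication by \<open>e\<^sup>z\<close> takes \<open>e\<^bsup>xz\<^esup>\<close>, the exponential generating function of the powers
  \<open>x\<^sup>n\<close>, to that of \<open>(x + 1)\<^sup>n\<close>. So \<open>e\<^sup>z - 1\<close> acts as the forward difference in \<open>x\<close>, and
  its \<open>k\<close>-th power is expanded by the binomial theorem.
\<close>
lemma fwd_diff_power_egf:
  "(fps_exp 1 - 1) ^ k * fps_exp (complex_of_real x) =
     Abs_fps (\<lambda>n. of_real (fwd_diff k (\<lambda>y. y ^ n) x) / fact n)"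
proof -
  have "(fps_exp 1 - 1 :: complex fps) ^ k =
          (\<Sum>j\<le>k. of_nat (k choose j) * fps_exp 1 ^ j * (-1) ^ (k - j))"
    using binomial_ring[of "fps_exp 1 :: complex fps" "-1" k] by simp
  also have "\<dots> * fps_exp (of_real x) =
     (\<Sum>j=0..k. fps_const (of_nat (k choose j) * (-1) ^ (k - j)) * fps_exp (of_real (x + real j)))"
    unfolding sum_distrib_right atMost_atLeast0
    by (intro sum.cong refl)
       (simp add: fps_exp_power_mult fps_exp_add_mult mult_ac fps_of_nat
          flip: fps_const_mult fps_const_power fps_const_neg)
  also have "\<dots> = Abs_fps (\<lambda>n. of_real (fwd_diff k (\<lambda>y. y ^ n) x) / fact n)"
    by (simp add: fps_eq_iff fps_sum_nth fwd_diff_def sum_divide_distrib)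
  finally show ?thesis .
qed

lemma gen_bernoulli_of_nat_fwd_diff:
  assumes "m \<ge> 1"
  shows "gen_bernoulli n (real m) x =
    (\<Sum>k=0..n. of_int (signed_stirling1 (m + k) m) / (fact k * real ((m + k) choose m))
              * fwd_diff k (\<lambda>y. y ^ n) x)"
proof -
  define a :: "nat \<Rightarrow> real" where
    "a = (\<lambda>k. of_int (signed_stirling1 (m + k) m) / (fact k * real ((m + k) choose m)))"
  let ?E = "fps_exp 1 - 1 :: complex fps"
  have pow_low: "fps_nth (?E ^ k) i = 0" if "i < k" for k i
    by (rule startsby_zero_power_prefix[rule_format]) (use that in auto)
  have "gen_bernoulli_fps (real m) x = (Abs_fps (\<lambda>k. of_real (a k)) oo ?E) * fps_exp (of_real x)"
    by (simp add: gen_bernoulli_fps_of_nat[OF assms] fps_X_div_exp_minus_1_power a_def)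
  moreover have "fps_nth ((Abs_fps (\<lambda>k. of_real (a k)) oo ?E) * fps_exp (of_real x)) n =
     (\<Sum>i=0..n. (\<Sum>k=0..i. of_real (a k) * fps_nth (?E ^ k) i) * fps_nth (fps_exp (of_real x)) (n - i))"
    by (simp add: fps_mult_nth fps_compose_nth)
  \<comment> \<open>The inner range is extended by vanishing terms, so that the two sums can be interchanged.\<close>
  moreover have "\<dots> =
     (\<Sum>i=0..n. (\<Sum>k=0..n. of_real (a k) * fps_nth (?E ^ k) i) * fps_nth (fps_exp (of_real x)) (n - i))"
    by (intro sum.cong refl arg_cong2[of _ _ _ _ "(*)"] sum.mono_neutral_left) (auto simp: pow_low)
  moreover have "\<dots> = (\<Sum>k=0..n. of_real (a k) * fps_nth (?E ^ k * fps_exp (of_real x)) n)"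
    by (simp only: fps_mult_nth sum_distrib_left sum_distrib_right mult.assoc) (rule sum.swap)
  moreover have "\<dots> = (\<Sum>k=0..n. of_real (a k) * (of_real (fwd_diff k (\<lambda>y. y ^ n) x) / fact n))"
    by (simp add: fwd_diff_power_egf)
  ultimately have "fps_nth (gen_bernoulli_fps (real m) x) n =
      (\<Sum>k=0..n. of_real (a k) * (of_real (fwd_diff k (\<lambda>y. y ^ n) x) / fact n))"
    by simp
  hence "complex_of_real (gen_bernoulli n (real m) x) =
      of_real (\<Sum>k=0..n. a k * fwd_diff k (\<lambda>y. y ^ n) x)"
    by (simp add: gen_bernoulli_fps_def flip: sum_divide_distrib)
  thus ?thesis
    by (simp only: of_real_eq_iff a_def)
qed

lemma gen_bernoulli_2_fwd_diff:
  "gen_bernoulli n 2 x =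
     2 * (\<Sum>k=0..n. (-1) ^ k * harm (k + 1) / real (k + 2) * fwd_diff k (\<lambda>y. y ^ n) x)"
proof -
  have coef: "of_int (signed_stirling1 (2 + k) 2) / (fact k * real ((2 + k) choose 2)) =
        2 * ((-1) ^ k * harm (k + 1) / real (k + 2))" for k
  proof -
    have denom: "fact k * real ((2 + k) choose 2) = real (k + 2) * fact (k + 1) / 2"
      by (simp add: binomial_fact field_simps)
    have "real_of_int (signed_stirling1 (2 + k) 2) = (-1) ^ k * fact (k + 1) * harm (k + 1)"
      using signed_stirling1_2[of k] by (simp only: add.commute[of 2])
    thus ?thesis
      unfolding denom by (simp del: fact_Suc)
  qed
  show ?thesis
    using gen_bernoulli_of_nat_fwd_diff[of 2 n x] unfolding coef
    by (simp add: sum_distrib_left mult.assoc)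
qed

theorem theorem6:
  fixes m n :: nat and xs :: "nat \<Rightarrow> real" and x :: real
  assumes "m \<ge> 1" and "(\<Sum>i=1..m. xs i) = x"
  shows
    "((\<Sum>j\<in>weak_compositions m n.
          multinomial n m j * (\<Prod>i=1..m. bernoulli_poly (j i) (xs i)))
        = gen_bernoulli n (real m) x
      \<and> gen_bernoulli n (real m) x
        = (\<Sum>k=0..n. of_int (signed_stirling1 (m + k) m) / (fact k * real ((m + k) choose m))
              * fwd_diff k (\<lambda>y. y ^ n) x))
     \<and> (m = 2 \<longrightarrow>
        (\<Sum>k=0..n. real (n choose k) * bernoulli_poly k (xs 1) * bernoulli_poly (n - k) (xs 2))
          = gen_bernoulli n 2 x
        \<and> gen_bernoulli n 2 x
          = 2 * (\<Sum>k=0..n. (-1) ^ k * harm (k + 1) / real (k + 2)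
              * fwd_diff k (\<lambda>y. y ^ n) x))"
proof -
  have multi: "(\<Sum>j\<in>weak_compositions m n.
          multinomial n m j * (\<Prod>i=1..m. bernoulli_poly (j i) (xs i))) = gen_bernoulli n (real m) x"
    using gen_bernoulli_convolution[OF assms(1), of n "\<lambda>_. 1" xs] assms(2)
    by (simp add: bernoulli_poly_def)
  have two: "(\<Sum>k=0..n. real (n choose k) * bernoulli_poly k (xs 1) * bernoulli_poly (n - k) (xs 2))
          = gen_bernoulli n 2 x" if "m = 2"
    using gen_bernoulli_convolution_binomial[of n 1 "xs 1" 1 "xs 2"] assms(2) that
    by (simp add: bernoulli_poly_def numeral_2_eq_2)
  show ?thesis
    using multi two gen_bernoulli_of_nat_fwd_diff[OF assms(1)] gen_bernoulli_2_fwd_diff by blast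
qed

end
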